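(* Consider a system of conservation laws $\partial_t u+\partial_x f(u)=0$ with entropy $U$, entropy variables $w$, entropy flux $F$ and flux potential $\psi$. Consider the semidiscrete scheme given on each element by $$\partial_t \underline{u} = -\mathrm{VOL}-\mathrm{SURF},\qquad \mathrm{VOL}_i=\sum_k 2D_{i,k}f^{\mathrm{vol}}(u_i,u_k),\qquad \mathrm{SURF}=M^{-1}R^TBN\big(\underline{f}^{\mathrm{num}}-R\underline{f}\big),$$ where $D,M,R,B,N$ form a summation-by-parts operator. If the numerical (volume) flux $f^{\mathrm{vol}}$ is consistent with $f$, symmetric, and entropy conservative, the nodal mass matrix $M$ is diagonal, and the boundary operator $R^TBNR$ is diagonal, too, then the semidiscrete scheme is entropy conservative (respectively entropy stable) across elements, if the numerical (surface) flux $f^{\mathrm{num}}$ is entropy conservative (respectively entropy stable).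
   Context: Entropy setting: $U$ is a strictly convex function of $u$, $w=U'(u)$, the entropy flux $F$ satisfies $F'(u)=U'(u)f'(u)$, and $\psi=w\cdot f-F$. Write $w_i=w(u_i)$, $\psi_i=\psi(u_i)$. Numerical fluxes: a numerical flux $g$ is a Lipschitz continuous two-point function $(u_-,u_+)\mapsto g(u_-,u_+)$ that is consistent with $f$, i.e. $g(u,u)=f(u)$. It is symmetric if $g(u_i,u_k)=g(u_k,u_i)$. It is entropy conservative (in the sense of Tadmor) if $(w_i-w_k)\cdot g(u_i,u_k)-(\psi_i-\psi_k)=0$, and entropy stable (in the sense of Tadmor) if $(w_i-w_k)\cdot g(u_i,u_k)-(\psi_i-\psi_k)\le 0$. In the stability condition, the first argument is the state on the right and the second the state on the left of the interface, i.e. with $u_-$ the left and $u_+$ the right state, the condition on the surface flux value $f^{\mathrm{num}}$ at the interface is $(w(u_+)-w(u_-))\cdot f^{\mathrm{num}}-(\psi(u_+)-\psi(u_-))\le 0$. These definitions apply to both the volume flux $f^{\mathrm{vol}}$ and the surface flux $f^{\mathrm{num}}$. SBP operator (one space dimension) on an element: functions are represented by their values $\underline u=(u_i)_i$ at pairwise different nodes; nonlinear operations are pointwise ($\underline f_i=f(u_i)$, etc.); matrices act componentwise on systems. $D$ is the derivative matrix, exact for polynomials of degree $\le p$ for some order of accuracy $p\in\mathbb N$ (in particular $D\underline 1=0$); $M$ is a mass matrix, approximating the $L_2$ scalar product on the element; $R$ is the restriction operator performing interpolation to the two boundary points (left, right); $B=\mathrm{diag}(1,1)$; $N=\mathrm{diag}(-1,1)$;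 $\underline u^TR^TBNR\,\underline v$ approximates the boundary term $uv|_{\text{right}}-uv|_{\text{left}}$, exactly for polynomials of degree $\le p$; and the SBP property $MD+D^TM=R^TBNR$ holds. The vector $\underline f^{\mathrm{num}}$ contains the surface numerical fluxes at the left and right boundary of the element. At each interface between two neighbouring elements one common value $f^{\mathrm{num}}$ is used by both elements, computed from the boundary states $u_-$ (from the element on the left) and $u_+$ (from the element on the right) of the numerical solution. Entropy conservation/stability across elements: the rate of change of the total entropy in one element is $\frac{d}{dt}\int U=\underline w^TM\partial_t\underline u$. The scheme is entropy conservative (stable) across elements if, after summing these rates over the elements, the contribution of each interface between two elements vanishes (is non-positive), so that, up to terms at the boundary of the whole domain, the total entropy is constant (non-increasing).
   Formalization: For order of accuracy p < 2 it is also assumed that R picks nodal values (boundary nodes are included); otherwise the claim fails, e.g. for Burgers' equation on two Gauss nodes with linear extrapolation. For p ≥ 2 this is proved from the diagonal boundary operator. *)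

theory Defs
  imports "HOL-Analysis.Analysis" "Jordan_Normal_Form.Gauss_Jordan_Elimination"
begin

no_notation scalar_prod (infix \<open>\<bullet>\<close> 70)

text \<open>Conservation law with an entropy. \<open>states\<close> is the set of admissible states (an open convex
  set, e.g. positive density and pressure for the Euler equations); the derivative of the entropy
  is identified with its gradient.\<close>

record 'a conservation_law =
  states :: "'a set"
  flux :: "'a \<Rightarrow> 'a"
  entropy :: "'a \<Rightarrow> real"
  entropy_var :: "'a \<Rightarrow> 'a"
  entropy_flux :: "'a \<Rightarrow> real"

definition strictly_convex_on :: "'a::real_vector set \<Rightarrow> ('a \<Rightarrow> real) \<Rightarrow> bool" where
  "strictly_convex_on S U \<longleftrightarrow> convex S \<and>
     (\<forall>x\<in>S. \<forall>y\<in>S. \<forall>t. x \<noteq> y \<longrightarrow> 0 < t \<longrightarrow> t < 1 \<longrightarrow>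
        U ((1 - t) *\<^sub>R x + t *\<^sub>R y) < (1 - t) * U x + t * U y)"

definition entropy_setting :: "'a::euclidean_space conservation_law \<Rightarrow> bool" where
  "entropy_setting c \<longleftrightarrow>
     open (states c) \<and> strictly_convex_on (states c) (entropy c) \<and>
     (\<forall>u\<in>states c.
        (GDERIV (entropy c) u :> entropy_var c u) \<and>
        (\<exists>f'. (flux c has_derivative f') (at u) \<and>
              (entropy_flux c has_derivative (\<lambda>h. entropy_var c u \<bullet> f' h)) (at u)))"

definition flux_potential :: "'a::real_inner conservation_law \<Rightarrow> 'a \<Rightarrow> real" where
  "flux_potential c u = entropy_var c u \<bullet> flux c u - entropy_flux c u"

text \<open>Lipschitz continuity is required on compact sets only: already the entropy conservative
  flux of Burgers' equation is not globally Lipschitz continuous on the real line.\<close>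

definition numerical_flux :: "'a::euclidean_space conservation_law \<Rightarrow> ('a \<Rightarrow> 'a \<Rightarrow> 'a) \<Rightarrow> bool" where
  "numerical_flux c g \<longleftrightarrow>
     (\<forall>C. compact C \<and> C \<subseteq> states c \<times> states c \<longrightarrow> (\<exists>L. L-lipschitz_on C (\<lambda>(a, b). g a b))) \<and>
     (\<forall>u\<in>states c. g u u = flux c u)"

definition symmetric_flux :: "'a conservation_law \<Rightarrow> ('a \<Rightarrow> 'a \<Rightarrow> 'a) \<Rightarrow> bool" where
  "symmetric_flux c g \<longleftrightarrow> (\<forall>a\<in>states c. \<forall>b\<in>states c. g a b = g b a)"

text \<open>Fluxes are applied as \<open>g um up\<close> with \<open>um\<close> the state on the left and \<open>up\<close> the state on the
  right of an interface.\<close>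

definition entropy_conservative_flux ::
    "'a::real_inner conservation_law \<Rightarrow> ('a \<Rightarrow> 'a \<Rightarrow> 'a) \<Rightarrow> bool" where
  "entropy_conservative_flux c g \<longleftrightarrow>
     (\<forall>um\<in>states c. \<forall>up\<in>states c.
        (entropy_var c up - entropy_var c um) \<bullet> g um up
          - (flux_potential c up - flux_potential c um) = 0)"

definition entropy_stable_flux ::
    "'a::real_inner conservation_law \<Rightarrow> ('a \<Rightarrow> 'a \<Rightarrow> 'a) \<Rightarrow> bool" where
  "entropy_stable_flux c g \<longleftrightarrow>
     (\<forall>um\<in>states c. \<forall>up\<in>states c.
        (entropy_var c up - entropy_var c um) \<bullet> g um up
          - (flux_potential c up - flux_potential c um) \<le> 0)"

text \<open>Index 0 of the two boundary points is the left one, index 1 the right one.\<close>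

record sbp_element =
  left_pt :: real
  right_pt :: real
  num_nodes :: nat
  node :: "nat \<Rightarrow> real"
  accuracy :: nat
  Dmat :: "real mat"
  Mmat :: "real mat"
  Rmat :: "real mat"

definition Bmat :: "real mat" where
  "Bmat = mat_diag 2 (\<lambda>_. 1)"

definition Nmat :: "real mat" where
  "Nmat = mat_diag 2 (\<lambda>b. if b = 0 then - 1 else 1)"

definition boundary_op :: "sbp_element \<Rightarrow> real mat" where
  "boundary_op S = (Rmat S)\<^sup>T * Bmat * Nmat * Rmat S"

definition nodal :: "sbp_element \<Rightarrow> real poly \<Rightarrow> real Matrix.vec" where
  "nodal S q = Matrix.vec (num_nodes S) (\<lambda>i. poly q (node S i))"

text \<open>The mass matrix is symmetric and positive definite. That it approximates the \<open>L\<^sub>2\<close> product needs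
  no separate clause: by the SBP property and the exactness of \<open>D\<close> and of the boundary
  operator, the quadrature it induces satisfies integration by parts exactly for polynomials of
  degree at most the accuracy.\<close>

definition sbp_operator :: "sbp_element \<Rightarrow> bool" where
  "sbp_operator S \<longleftrightarrow> (let n = num_nodes S; D = Dmat S; M = Mmat S; R = Rmat S; p = accuracy S in
     left_pt S < right_pt S \<and>
     inj_on (node S) {..<n} \<and> node S ` {..<n} \<subseteq> {left_pt S..right_pt S} \<and>
     D \<in> carrier_mat n n \<and> M \<in> carrier_mat n n \<and> R \<in> carrier_mat 2 n \<and>
     (\<forall>q. degree q \<le> p \<longrightarrow> D *\<^sub>v nodal S q = nodal S (pderiv q)) \<and>
     M\<^sup>T = M \<and> (\<forall>v\<in>carrier_vec n. v \<noteq> 0\<^sub>v n \<longrightarrow> scalar_prod v (M *\<^sub>v v) > 0) \<and>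
     (\<forall>q. degree q \<le> p \<longrightarrow> R *\<^sub>v nodal S q = vec_of_list [poly q (left_pt S), poly q (right_pt S)]) \<and>
     (\<forall>q r. degree q \<le> p \<longrightarrow> degree r \<le> p \<longrightarrow>
        scalar_prod (nodal S q) (boundary_op S *\<^sub>v nodal S r)
          = poly q (right_pt S) * poly r (right_pt S) - poly q (left_pt S) * poly r (left_pt S)) \<and>
     M * D + D\<^sup>T * M = boundary_op S)"

text \<open>The restriction to the boundary picks nodal values. If the accuracy is at least 2, this follows
  for an SBP operator with diagonal boundary operator. For smaller accuracy it does not: the two
  Gauss nodes \<open>-1/sqrt 3, 1/sqrt 3\<close> on \<open>[-1, 1]\<close> with linear extrapolation to the boundary give
  accuracy 1 and diagonal \<open>M\<close> and \<open>R\<^sup>T B N R\<close>.\<close>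

definition nodal_restriction :: "sbp_element \<Rightarrow> bool" where
  "nodal_restriction S \<longleftrightarrow>
     (\<forall>b<2. \<exists>i<num_nodes S. Matrix.row (Rmat S) b = unit_vec (num_nodes S) i)"

text \<open>Componentwise action of a matrix on a family of state vectors.\<close>

definition mat_app :: "real mat \<Rightarrow> (nat \<Rightarrow> 'a::real_vector) \<Rightarrow> nat \<Rightarrow> 'a" where
  "mat_app A v i = (\<Sum>k<dim_col A. A $$ (i, k) *\<^sub>R v k)"

definition vol_term :: "('a::real_vector \<Rightarrow> 'a \<Rightarrow> 'a) \<Rightarrow> sbp_element \<Rightarrow> (nat \<Rightarrow> 'a) \<Rightarrow> nat \<Rightarrow> 'a" where
  "vol_term fvol S u i = (\<Sum>k<num_nodes S. (2 * Dmat S $$ (i, k)) *\<^sub>R fvol (u i) (u k))"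

definition surf_term ::
    "'a::real_vector conservation_law \<Rightarrow> sbp_element \<Rightarrow> (nat \<Rightarrow> 'a) \<Rightarrow> (nat \<Rightarrow> 'a) \<Rightarrow> nat \<Rightarrow> 'a" where
  "surf_term c S u fb =
     mat_app (the (mat_inverse (Mmat S)) * (Rmat S)\<^sup>T * Bmat * Nmat)
       (\<lambda>b. fb b - mat_app (Rmat S) (\<lambda>k. flux c (u k)) b)"

text \<open>\<open>fb\<close> holds the values of the surface flux at the left and right end of the element.\<close>

definition element_rhs ::
    "'a::real_vector conservation_law \<Rightarrow> ('a \<Rightarrow> 'a \<Rightarrow> 'a) \<Rightarrow> sbp_element \<Rightarrow>
     (nat \<Rightarrow> 'a) \<Rightarrow> (nat \<Rightarrow> 'a) \<Rightarrow> nat \<Rightarrow> 'a" where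
  "element_rhs c fvol S u fb i = - vol_term fvol S u i - surf_term c S u fb i"

text \<open>The mesh is the list of its elements from left to right; a discrete state is
  \<open>u j i\<close> with element index \<open>j\<close> and node index \<open>i\<close>.\<close>

definition mesh :: "sbp_element list \<Rightarrow> bool" where
  "mesh els \<longleftrightarrow> els \<noteq> [] \<and> (\<forall>S\<in>set els. sbp_operator S) \<and>
     (\<forall>j. Suc j < length els \<longrightarrow> right_pt (els ! j) = left_pt (els ! Suc j))"

definition admissible ::
    "'a conservation_law \<Rightarrow> sbp_element list \<Rightarrow> (nat \<Rightarrow> nat \<Rightarrow> 'a) \<Rightarrow> bool" where
  "admissible c els u \<longleftrightarrow> (\<forall>j<length els. \<forall>i<num_nodes (els ! j). u j i \<in> states c)"

definition left_state :: "sbp_element list \<Rightarrow> (nat \<Rightarrow> nat \<Rightarrow> 'a::real_vector) \<Rightarrow> nat \<Rightarrow> 'a" where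
  "left_state els u j = mat_app (Rmat (els ! j)) (u j) 0"

definition right_state :: "sbp_element list \<Rightarrow> (nat \<Rightarrow> nat \<Rightarrow> 'a::real_vector) \<Rightarrow> nat \<Rightarrow> 'a" where
  "right_state els u j = mat_app (Rmat (els ! j)) (u j) 1"

text \<open>Point \<open>j\<close> is the left end of element \<open>j\<close>. At the two ends of the domain the surface flux values
  \<open>gl\<close> and \<open>gr\<close> are left open, since they depend on the boundary conditions.\<close>

definition surface_flux ::
    "('a::real_vector \<Rightarrow> 'a \<Rightarrow> 'a) \<Rightarrow> sbp_element list \<Rightarrow> 'a \<Rightarrow> 'a \<Rightarrow> (nat \<Rightarrow> nat \<Rightarrow> 'a) \<Rightarrow> nat \<Rightarrow> 'a" where
  "surface_flux fnum els gl gr u j =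
     (if j = 0 then gl else if j = length els then gr
      else fnum (right_state els u (j - 1)) (left_state els u j))"

definition scheme_solution ::
    "'a::real_normed_vector conservation_law \<Rightarrow> ('a \<Rightarrow> 'a \<Rightarrow> 'a) \<Rightarrow> ('a \<Rightarrow> 'a \<Rightarrow> 'a) \<Rightarrow> sbp_element list \<Rightarrow>
     real set \<Rightarrow> (real \<Rightarrow> 'a) \<Rightarrow> (real \<Rightarrow> 'a) \<Rightarrow> (real \<Rightarrow> nat \<Rightarrow> nat \<Rightarrow> 'a) \<Rightarrow> bool" where
  "scheme_solution c fvol fnum els T gl gr u \<longleftrightarrow> is_interval T \<and>
     (\<forall>t\<in>T. admissible c els (u t) \<and>
        (\<forall>j<length els. \<forall>i<num_nodes (els ! j).
           ((\<lambda>s. u s j i) has_vector_derivative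
              element_rhs c fvol (els ! j) (u t j)
                (\<lambda>b. surface_flux fnum els (gl t) (gr t) (u t) (j + b)) i) (at t within T)))"

text \<open>The rate \<open>w\<^sup>T M \<partial>\<^sub>t u\<close> of the entropy in an element, with \<open>du\<close> in the place of \<open>\<partial>\<^sub>t u\<close>.\<close>

definition entropy_rate ::
    "'a::real_inner conservation_law \<Rightarrow> sbp_element \<Rightarrow> (nat \<Rightarrow> 'a) \<Rightarrow> (nat \<Rightarrow> 'a) \<Rightarrow> real" where
  "entropy_rate c S u du = (\<Sum>i<num_nodes S. entropy_var c (u i) \<bullet> mat_app (Mmat S) du i)"

definition total_entropy ::
    "'a conservation_law \<Rightarrow> sbp_element list \<Rightarrow> (nat \<Rightarrow> nat \<Rightarrow> 'a) \<Rightarrow> real" where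
  "total_entropy c els u =
     (\<Sum>j<length els. \<Sum>i<num_nodes (els ! j). mat_app (Mmat (els ! j)) (\<lambda>k. entropy c (u j k)) i)"

text \<open>\<open>h\<close> splits the entropy rate of every element, for all states and all surface flux values, into a
  contribution of its right end minus one of its left end. The two depend only on the boundary
  state and the surface flux value there. Summing over the elements then assigns to each interface
  the difference \<open>interface_contribution\<close>, as both neighbours use the same flux value.\<close>

definition boundary_splitting ::
    "'a::real_inner conservation_law \<Rightarrow> ('a \<Rightarrow> 'a \<Rightarrow> 'a) \<Rightarrow> sbp_element list \<Rightarrow> ('a \<Rightarrow> 'a \<Rightarrow> real) \<Rightarrow> bool" where
  "boundary_splitting c fvol els h \<longleftrightarrow>
     (\<forall>S\<in>set els. \<forall>v fb. (\<forall>i<num_nodes S. v i \<in> states c) \<longrightarrow>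
        entropy_rate c S v (element_rhs c fvol S v fb)
          = h (mat_app (Rmat S) v 1) (fb 1) - h (mat_app (Rmat S) v 0) (fb 0))"

definition interface_contribution ::
    "('a::real_vector \<Rightarrow> 'a \<Rightarrow> 'a) \<Rightarrow> sbp_element list \<Rightarrow> ('a \<Rightarrow> 'a \<Rightarrow> real) \<Rightarrow>
     (nat \<Rightarrow> nat \<Rightarrow> 'a) \<Rightarrow> nat \<Rightarrow> real" where
  "interface_contribution fnum els h u j =
     (let um = right_state els u j; up = left_state els u (Suc j); g = fnum um up
      in h um g - h up g)"

definition domain_boundary_term ::
    "sbp_element list \<Rightarrow> ('a::real_vector \<Rightarrow> 'a \<Rightarrow> real) \<Rightarrow> 'a \<Rightarrow> 'a \<Rightarrow> (nat \<Rightarrow> nat \<Rightarrow> 'a) \<Rightarrow> real" where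
  "domain_boundary_term els h gl gr u =
     h (right_state els u (length els - 1)) gr - h (left_state els u 0) gl"

definition entropy_conservative_across_elements ::
    "'a::real_inner conservation_law \<Rightarrow> ('a \<Rightarrow> 'a \<Rightarrow> 'a) \<Rightarrow> ('a \<Rightarrow> 'a \<Rightarrow> 'a) \<Rightarrow> sbp_element list \<Rightarrow> bool" where
  "entropy_conservative_across_elements c fvol fnum els \<longleftrightarrow>
     (\<exists>h. boundary_splitting c fvol els h \<and>
        (\<forall>u j. admissible c els u \<longrightarrow> Suc j < length els \<longrightarrow>
           interface_contribution fnum els h u j = 0) \<and>
        (\<forall>T gl gr u. scheme_solution c fvol fnum els T gl gr u \<longrightarrow>
           (\<forall>t\<in>T. ((\<lambda>s. total_entropy c els (u s)) has_real_derivative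
               domain_boundary_term els h (gl t) (gr t) (u t)) (at t within T))))"

definition entropy_stable_across_elements ::
    "'a::real_inner conservation_law \<Rightarrow> ('a \<Rightarrow> 'a \<Rightarrow> 'a) \<Rightarrow> ('a \<Rightarrow> 'a \<Rightarrow> 'a) \<Rightarrow> sbp_element list \<Rightarrow> bool" where
  "entropy_stable_across_elements c fvol fnum els \<longleftrightarrow>
     (\<exists>h. boundary_splitting c fvol els h \<and>
        (\<forall>u j. admissible c els u \<longrightarrow> Suc j < length els \<longrightarrow>
           interface_contribution fnum els h u j \<le> 0) \<and>
        (\<forall>T gl gr u. scheme_solution c fvol fnum els T gl gr u \<longrightarrow>
           (\<forall>t\<in>T. \<exists>d. ((\<lambda>s. total_entropy c els (u s)) has_real_derivative d) (at t within T) \<and>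
               d \<le> domain_boundary_term els h (gl t) (gr t) (u t))))"

end

theory Submission
  imports Defs "Jordan_Normal_Form.Determinant"
begin

text \<open>Since \<open>M\<close> is diagonal, the volume term contributes \<open>\<Sum> 2 Q\<^sub>i\<^sub>k w\<^sub>i \<bullet> f\<^sup>v\<^sup>o\<^sup>l(u\<^sub>i, u\<^sub>k)\<close> with \<open>Q = M D\<close> to the
  entropy rate. Replacing one of the two copies of \<open>Q\<close> by \<open>E - Q\<^sup>T\<close>, where \<open>E = R\<^sup>T B N R\<close>, turns it into
  jumps \<open>(w\<^sub>i - w\<^sub>k) \<bullet> f\<^sup>v\<^sup>o\<^sup>l(u\<^sub>i, u\<^sub>k) = \<psi>\<^sub>i - \<psi>\<^sub>k\<close>, which telescope to boundary terms because \<open>D\<close> annihilates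
  constants. As the boundary states are nodal values, the surface term turns what remains into
  \<open>\<psi>(u) - w(u) \<bullet> g\<close> at the right end minus the same expression at the left end, with \<open>g\<close> the surface
  flux there. At an interface the two contributions combine to Tadmor's expression.\<close>

no_notation scalar_prod (infix \<open>\<bullet>\<close> 70)

section \<open>Entries of the boundary matrices and the exactness conditions\<close>

text \<open>The outward normal at the two boundary points. Since \<open>Bmat\<close> is the
  identity, it is all that \<open>Bmat * Nmat\<close> contributes.\<close>

definition boundary_sign :: "nat \<Rightarrow> real" where
  "boundary_sign b = (if b = 0 then - 1 else 1)"

lemma sbp_carrier:
  assumes "sbp_operator S"
  shows "Dmat S \<in> carrier_mat (num_nodes S) (num_nodes S)"
    and "Mmat S \<in> carrier_mat (num_nodes S) (num_nodes S)"
    and "Rmat S \<in> carrier_mat 2 (num_nodes S)"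
    and "Mmat S * Dmat S + (Dmat S)\<^sup>T * Mmat S = boundary_op S"
    and "left_pt S < right_pt S"
    and "inj_on (node S) {..<num_nodes S}"
  using assms unfolding sbp_operator_def Let_def by auto

lemma transpose_Rmat_B_N:
  assumes "R \<in> carrier_mat 2 n"
  shows "R\<^sup>T * Bmat * Nmat = mat n 2 (\<lambda>(i, b). boundary_sign b * R $$ (b, i))"
proof -
  have T: "R\<^sup>T \<in> carrier_mat n 2" using assms by simp
  have B: "R\<^sup>T * Bmat = R\<^sup>T"
    unfolding Bmat_def mat_diag_mult_right[OF T] using T by (intro eq_matI) auto
  show ?thesis
    unfolding B Nmat_def mat_diag_mult_right[OF T]
    using assms by (intro eq_matI) (auto simp: boundary_sign_def)
qed

lemma boundary_op_entry:
  assumes "Rmat S \<in> carrier_mat 2 (num_nodes S)" "i < num_nodes S" "k < num_nodes S"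
  shows "boundary_op S $$ (i, k) = Rmat S $$ (1, i) * Rmat S $$ (1, k) - Rmat S $$ (0, i) * Rmat S $$ (0, k)"
proof -
  have "boundary_op S $$ (i, k) = (\<Sum>b\<in>{0..<2}. boundary_sign b * Rmat S $$ (b, i) * Rmat S $$ (b, k))"
    unfolding boundary_op_def transpose_Rmat_B_N[OF assms(1)]
    using assms by (simp add: scalar_prod_def)
  then show ?thesis by (simp add: boundary_sign_def numeral_2_eq_2)
qed

text \<open>Exactness of \<open>D\<close> for the constant polynomial 1, whose degree 0 is within
  every order of accuracy.\<close>

lemma derivative_row_sum:
  assumes "sbp_operator S" "i < num_nodes S"
  shows "(\<Sum>k<num_nodes S. Dmat S $$ (i, k)) = 0"
proof -
  have "Dmat S *\<^sub>v nodal S 1 = nodal S (pderiv 1)"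
    using assms(1) unfolding sbp_operator_def Let_def by auto
  then have "vec_index (Dmat S *\<^sub>v nodal S 1) i = vec_index (nodal S (pderiv 1)) i" by simp
  then show ?thesis
    using assms sbp_carrier(1)[OF assms(1)]
    by (simp add: nodal_def scalar_prod_def lessThan_atLeast0)
qed

lemma restriction_exact:
  assumes "sbp_operator S" "degree q \<le> accuracy S"
  shows "(\<Sum>k<num_nodes S. Rmat S $$ (0, k) * poly q (node S k)) = poly q (left_pt S)"
    and "(\<Sum>k<num_nodes S. Rmat S $$ (1, k) * poly q (node S k)) = poly q (right_pt S)"
proof -
  have eq: "Rmat S *\<^sub>v nodal S q = vec_of_list [poly q (left_pt S), poly q (right_pt S)]"
    using assms unfolding sbp_operator_def Let_def by auto
  have "vec_index (Rmat S *\<^sub>v nodal S q) b = (\<Sum>k<num_nodes S. Rmat S $$ (b, k) * poly q (node S k))" if "b < 2" for b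
    using that sbp_carrier(3)[OF assms(1)]
    by (simp add: nodal_def scalar_prod_def lessThan_atLeast0)
  from this[of 0] this[of 1]
  show "(\<Sum>k<num_nodes S. Rmat S $$ (0, k) * poly q (node S k)) = poly q (left_pt S)"
    and "(\<Sum>k<num_nodes S. Rmat S $$ (1, k) * poly q (node S k)) = poly q (right_pt S)"
    unfolding eq by simp_all
qed

section \<open>From a diagonal boundary operator to boundary values at nodes\<close>

text \<open>Row \<open>i\<close> of the boundary operator, applied to the nodal values of
  \<open>q\<close>, is evaluated twice: by diagonality only the term of node \<open>i\<close>
  survives, while the form \<open>r r\<^sup>T - l l\<^sup>T\<close> together with exactness of the
  restriction produces the end point values.\<close>

lemma diagonal_boundary_op_exact:
  assumes S: "sbp_operator S" and diag: "diagonal_mat (boundary_op S)"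
    and deg: "degree q \<le> accuracy S" and i: "i < num_nodes S"
  shows "(Rmat S $$ (1, i) * Rmat S $$ (1, i) - Rmat S $$ (0, i) * Rmat S $$ (0, i)) * poly q (node S i)
    = Rmat S $$ (1, i) * poly q (right_pt S) - Rmat S $$ (0, i) * poly q (left_pt S)"
proof -
  let ?n = "num_nodes S" and ?E = "boundary_op S" and ?R = "Rmat S"
  note R = sbp_carrier(3)[OF S]
  have dims: "dim_row ?E = ?n" "dim_col ?E = ?n" using R by (simp_all add: boundary_op_def)
  have "?E $$ (i, k) = 0" if "k < ?n" "k \<noteq> i" for k
    using diag i that dims unfolding diagonal_mat_def by auto
  then have "(\<Sum>k<?n. ?E $$ (i, k) * poly q (node S k)) = (\<Sum>k<?n. if k = i then ?E $$ (i, i) * poly q (node S i) else 0)"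
    by (intro sum.cong) auto
  also have "\<dots> = ?E $$ (i, i) * poly q (node S i)" using i by simp
  finally have "?E $$ (i, i) * poly q (node S i) = (\<Sum>k<?n. ?E $$ (i, k) * poly q (node S k))" ..
  also have "\<dots> = ?R $$ (1, i) * (\<Sum>k<?n. ?R $$ (1, k) * poly q (node S k))
      - ?R $$ (0, i) * (\<Sum>k<?n. ?R $$ (0, k) * poly q (node S k))"
    unfolding sum_distrib_left sum_subtractf[symmetric]
    by (intro sum.cong refl) (simp add: boundary_op_entry[OF R i] algebra_simps)
  finally show ?thesis
    unfolding restriction_exact[OF S deg] boundary_op_entry[OF R i i] .
qed

text \<open>Two nonzero weights would sit at distinct nodes with the same position \<open>a\<close>,
  against injectivity. So a single weight carries the whole sum 1.\<close>

lemma unit_row: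
  fixes \<rho> x :: "nat \<Rightarrow> real"
  assumes sum: "(\<Sum>k<n. \<rho> k) = 1" and supp: "\<And>k. k < n \<Longrightarrow> x k = a \<or> \<rho> k = 0"
    and inj: "inj_on x {..<n}"
  obtains m where "m < n" "\<And>k. k < n \<Longrightarrow> \<rho> k = (if k = m then 1 else 0)"
proof -
  have "\<exists>m<n. \<rho> m \<noteq> 0"
  proof (rule ccontr)
    assume "\<not> (\<exists>m<n. \<rho> m \<noteq> 0)"
    then have "(\<Sum>k<n. \<rho> k) = 0" by (intro sum.neutral) auto
    with sum show False by simp
  qed
  then obtain m where m: "m < n" "\<rho> m \<noteq> 0" by blast
  have zero: "\<rho> k = 0" if "k < n" "k \<noteq> m" for k
    using supp[of k] supp[of m] m that inj unfolding inj_on_def by auto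
  have "(\<Sum>k<n. \<rho> k) = (\<Sum>k<n. if k = m then \<rho> m else 0)"
    using zero by (intro sum.cong) auto
  then have "\<rho> m = 1" using sum m by simp
  with zero m show ?thesis by (intro that[of m]) auto
qed

text \<open>With \<open>E = r r\<^sup>T - l l\<^sup>T\<close> diagonal, applying \<open>E\<close> to the values of \<open>1, x, x\<^sup>2\<close> at the nodes shows
  \<open>(x\<^sub>i - a) l\<^sub>i = 0\<close> and \<open>(x\<^sub>i - b) r\<^sub>i = 0\<close>, where \<open>a, b\<close> are the end points.\<close>

lemma nodal_restriction_if_diagonal_boundary_op:
  assumes S: "sbp_operator S" and diag: "diagonal_mat (boundary_op S)" and acc: "2 \<le> accuracy S"
  shows "nodal_restriction S"
proof -
  let ?n = "num_nodes S" and ?R = "Rmat S" and ?a = "left_pt S" and ?b = "right_pt S"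
  note R = sbp_carrier(3)[OF S]
  have ab: "?a < ?b" and inj: "inj_on (node S) {..<?n}" using sbp_carrier[OF S] by auto
  have supp: "node S i = ?a \<or> ?R $$ (0, i) = 0" "node S i = ?b \<or> ?R $$ (1, i) = 0" if i: "i < ?n" for i
  proof -
    define r l x e where "r = ?R $$ (1, i)" "l = ?R $$ (0, i)" "x = node S i" "e = r * r - l * l"
    have e0: "e = r - l"
      using diagonal_boundary_op_exact[OF S diag _ i, of 1] by (simp add: r_l_x_e_def)
    have e1: "e * x = r * ?b - l * ?a"
      using diagonal_boundary_op_exact[OF S diag _ i, of "[:0, 1:]"] acc by (simp add: r_l_x_e_def)
    have e2: "e * (x * x) = r * (?b * ?b) - l * (?a * ?a)"
      using diagonal_boundary_op_exact[OF S diag _ i, of "[:0, 0, 1:]"] acc by (simp add: r_l_x_e_def)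
    have lin: "(x - ?b) * r = (x - ?a) * l"
      using e1 unfolding e0 by (simp add: algebra_simps)
    \<comment> \<open>The condition from \<open>x\<^sup>2\<close> factors through differences of
      squares. Replacing \<open>(x - ?b) * r\<close> by \<open>lin\<close> puts the same factor
      \<open>(x - ?a) * l\<close> on both sides, with coefficients that differ by
      \<open>?b - ?a\<close>, which is positive.\<close>
    have "(x + ?b) * ((x - ?b) * r) = (x + ?a) * ((x - ?a) * l)"
      using e2 unfolding e0 by (simp add: algebra_simps)
    then have "(?b - ?a) * ((x - ?a) * l) = 0"
      unfolding lin by (simp add: algebra_simps)
    then have "(x - ?a) * l = 0" using ab by simp
    with lin have "x = ?a \<or> l = 0" "x = ?b \<or> r = 0" by auto
    then show "node S i = ?a \<or> ?R $$ (0, i) = 0" "node S i = ?b \<or> ?R $$ (1, i) = 0"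
      by (simp_all add: r_l_x_e_def)
  qed
  have sums: "(\<Sum>k<?n. ?R $$ (0, k)) = 1" "(\<Sum>k<?n. ?R $$ (1, k)) = 1"
    using restriction_exact[OF S, of 1] by simp_all
  have unit: "Matrix.row ?R b = unit_vec ?n m"
    if "b < 2" "\<And>k. k < ?n \<Longrightarrow> ?R $$ (b, k) = (if k = m then 1 else 0)" for b m
    using that R by (intro eq_vecI) (auto simp: unit_vec_def)
  obtain l where l: "l < ?n" "\<And>k. k < ?n \<Longrightarrow> ?R $$ (0, k) = (if k = l then 1 else 0)"
    using unit_row[OF sums(1) supp(1) inj] by blast
  obtain r where r: "r < ?n" "\<And>k. k < ?n \<Longrightarrow> ?R $$ (1, k) = (if k = r then 1 else 0)"
    using unit_row[OF sums(2) supp(2) inj] by blast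
  show ?thesis
    unfolding nodal_restriction_def
  proof (intro allI impI)
    fix b :: nat assume "b < 2"
    then consider "b = 0" | "b = 1" by linarith
    then show "\<exists>i<?n. Matrix.row ?R b = unit_vec ?n i"
      by cases (use unit[of 0 l] unit[of 1 r] l r in auto)
  qed
qed

text \<open>Names the two boundary nodes and describes the restriction both by its entries, as
  needed for the boundary operator, and by its action on states, which makes boundary states nodal
  values.\<close>

lemma nodal_restrictionE:
  assumes "nodal_restriction S" and R: "Rmat S \<in> carrier_mat 2 (num_nodes S)"
  obtains l r where "l < num_nodes S" "r < num_nodes S"
    "\<And>k. k < num_nodes S \<Longrightarrow> Rmat S $$ (0, k) = (if k = l then 1 else 0)"
    "\<And>k. k < num_nodes S \<Longrightarrow> Rmat S $$ (1, k) = (if k = r then 1 else 0)"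
    "\<And>v :: nat \<Rightarrow> 'a::real_vector. mat_app (Rmat S) v 0 = v l"
    "\<And>v :: nat \<Rightarrow> 'a. mat_app (Rmat S) v 1 = v r"
proof -
  let ?n = "num_nodes S" and ?R = "Rmat S"
  obtain l r where l: "l < ?n" "Matrix.row ?R 0 = unit_vec ?n l" and r: "r < ?n" "Matrix.row ?R 1 = unit_vec ?n r"
    using assms(1) unfolding nodal_restriction_def by (metis one_less_numeral_iff semiring_norm(76) zero_less_numeral)
  have entry: "?R $$ (b, k) = (if k = m then 1 else 0)"
    if "b < 2" "k < ?n" "Matrix.row ?R b = unit_vec ?n m" "m < ?n" for b k m
    using arg_cong[OF that(3), of "\<lambda>v. vec_index v k"] that(1,2,4) R by auto
  have app: "mat_app ?R v b = v m"
    if "b < 2" "Matrix.row ?R b = unit_vec ?n m" "m < ?n" for b m and v :: "nat \<Rightarrow> 'a"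
  proof -
    have "mat_app ?R v b = (\<Sum>k<?n. if k = m then v m else 0)"
      unfolding mat_app_def using R entry that by (intro sum.cong) auto
    then show ?thesis using that by simp
  qed
  show ?thesis
    by (rule that[of l r]) (use l r entry app in auto)
qed

section \<open>Diagonal matrices, the inverse mass matrix and the surface term\<close>

lemma mat_app_diagonal:
  assumes "diagonal_mat A" "A \<in> carrier_mat n n" "i < n"
  shows "mat_app A v i = A $$ (i, i) *\<^sub>R v i"
proof -
  have "mat_app A v i = (\<Sum>k<n. if k = i then A $$ (i, i) *\<^sub>R v i else 0)"
    unfolding mat_app_def using assms by (intro sum.cong) (auto simp: diagonal_mat_def)
  then show ?thesis using assms by simp
qed

lemma diagonal_mult_entry:
  fixes A C :: "real mat"
  assumes "diagonal_mat A" "A \<in> carrier_mat n n" "C \<in> carrier_mat n m" "i < n" "k < m"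
  shows "(A * C) $$ (i, k) = A $$ (i, i) * C $$ (i, k)"
proof -
  have "(A * C) $$ (i, k) = (\<Sum>j<n. A $$ (i, j) * C $$ (j, k))"
    using assms by (simp add: scalar_prod_def lessThan_atLeast0)
  also have "\<dots> = (\<Sum>j<n. if j = i then A $$ (i, i) * C $$ (i, k) else 0)"
    using assms by (intro sum.cong) (auto simp: diagonal_mat_def)
  finally show ?thesis using assms by simp
qed

lemma mult_diagonal_entry:
  fixes A C :: "real mat"
  assumes "diagonal_mat A" "A \<in> carrier_mat n n" "C \<in> carrier_mat m n" "i < m" "k < n"
  shows "(C * A) $$ (i, k) = A $$ (k, k) * C $$ (i, k)"
proof -
  have "(C * A) $$ (i, k) = (\<Sum>j<n. C $$ (i, j) * A $$ (j, k))"
    using assms by (simp add: scalar_prod_def lessThan_atLeast0)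
  also have "\<dots> = (\<Sum>j<n. if j = k then A $$ (k, k) * C $$ (i, k) else 0)"
    using assms by (intro sum.cong) (auto simp: diagonal_mat_def)
  finally show ?thesis using assms by simp
qed

lemma mat_app_mult:
  assumes "A \<in> carrier_mat m n" "C \<in> carrier_mat n l" "i < m"
  shows "mat_app (A * C) v i = mat_app A (mat_app C v) i"
proof -
  have "mat_app (A * C) v i = (\<Sum>k<l. \<Sum>j<n. (A $$ (i, j) * C $$ (j, k)) *\<^sub>R v k)"
    unfolding mat_app_def using assms
    by (simp add: scalar_prod_def lessThan_atLeast0 scaleR_sum_left)
  also have "\<dots> = (\<Sum>j<n. \<Sum>k<l. (A $$ (i, j) * C $$ (j, k)) *\<^sub>R v k)" by (rule sum.swap)
  also have "\<dots> = mat_app A (mat_app C v) i"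
    unfolding mat_app_def using assms by (simp add: scaleR_sum_right)
  finally show ?thesis .
qed

text \<open>Positive definiteness excludes a nonzero kernel vector, so the determinant is nonzero
  and \<open>mat_inverse\<close> returns \<open>Some\<close>. This gives \<open>the\<close> in
  \<open>surf_term\<close> its intended meaning.\<close>

lemma mass_inverse:
  assumes "sbp_operator S"
  shows "the (mat_inverse (Mmat S)) \<in> carrier_mat (num_nodes S) (num_nodes S)"
    and "Mmat S * the (mat_inverse (Mmat S)) = 1\<^sub>m (num_nodes S)"
proof -
  let ?n = "num_nodes S" and ?M = "Mmat S"
  note M = sbp_carrier(2)[OF assms]
  have pos: "\<And>v. v \<in> carrier_vec ?n \<Longrightarrow> v \<noteq> 0\<^sub>v ?n \<Longrightarrow> scalar_prod v (?M *\<^sub>v v) > 0"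
    using assms unfolding sbp_operator_def Let_def by auto
  have "Determinant.det ?M \<noteq> 0"
  proof
    assume "Determinant.det ?M = 0"
    then obtain v where "v \<in> carrier_vec ?n" "v \<noteq> 0\<^sub>v ?n" "?M *\<^sub>v v = 0\<^sub>v ?n"
      using det_0_iff_vec_prod_zero[OF M] by blast
    with pos[of v] show False by simp
  qed
  then have unit: "?M \<in> Units (ring_mat TYPE(real) ?n ())" by (rule det_non_zero_imp_unit[OF M])
  then obtain Mi where Mi: "mat_inverse ?M = Some Mi"
    using mat_inverse(1)[OF M, of "()"] by (cases "mat_inverse ?M") auto
  from mat_inverse(2)[OF M Mi] show "the (mat_inverse ?M) \<in> carrier_mat ?n ?n"
    and "?M * the (mat_inverse ?M) = 1\<^sub>m ?n" unfolding Mi by auto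
qed

text \<open>The mass matrix cancels its inverse. What is left is \<open>R\<^sup>T B N\<close>, with
  one signed term for each end.\<close>

lemma mass_surf_term:
  assumes S: "sbp_operator S" and i: "i < num_nodes S"
  shows "mat_app (Mmat S) (surf_term c S u fb) i =
    Rmat S $$ (1, i) *\<^sub>R (fb 1 - mat_app (Rmat S) (\<lambda>k. flux c (u k)) 1)
    - Rmat S $$ (0, i) *\<^sub>R (fb 0 - mat_app (Rmat S) (\<lambda>k. flux c (u k)) 0)"
proof -
  let ?n = "num_nodes S" and ?M = "Mmat S" and ?R = "Rmat S"
  let ?Mi = "the (mat_inverse ?M)" and ?C = "?R\<^sup>T * Bmat * Nmat"
  define v where "v = (\<lambda>b. fb b - mat_app ?R (\<lambda>k. flux c (u k)) b)"
  note M = sbp_carrier(2)[OF S] and R = sbp_carrier(3)[OF S] and Mi = mass_inverse[OF S]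
  have RT: "?R\<^sup>T \<in> carrier_mat ?n 2" using R by simp
  have B: "Bmat \<in> carrier_mat 2 2" and N: "Nmat \<in> carrier_mat 2 2"
    by (simp_all add: Bmat_def Nmat_def mat_diag_def)
  have C: "?C \<in> carrier_mat ?n 2" using RT B N by simp
  \<comment> \<open>The product in \<open>surf_term\<close> is grouped to the left; regrouping
    isolates the inverse as the first factor, next to \<open>?M\<close>.\<close>
  have assoc: "?Mi * ?R\<^sup>T * Bmat * Nmat = ?Mi * ?C"
  proof -
    have "?Mi * ?R\<^sup>T * Bmat = ?Mi * (?R\<^sup>T * Bmat)" by (rule assoc_mult_mat[OF Mi(1) RT B])
    also have "\<dots> * Nmat = ?Mi * ?C" by (rule assoc_mult_mat[OF Mi(1) _ N]) (use RT B in simp)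
    finally show ?thesis .
  qed
  have "?M * (?Mi * ?C) = (?M * ?Mi) * ?C" by (rule assoc_mult_mat[OF M Mi(1) C, symmetric])
  then have MC: "?M * (?Mi * ?C) = ?C" unfolding Mi(2) left_mult_one_mat[OF C] .
  have "mat_app ?M (surf_term c S u fb) i = mat_app (?M * (?Mi * ?C)) v i"
    unfolding surf_term_def assoc v_def[symmetric]
    by (rule mat_app_mult[OF M mult_carrier_mat[OF Mi(1) C] i, symmetric])
  also have "\<dots> = mat_app ?C v i" unfolding MC ..
  also have "\<dots> = ?R $$ (1, i) *\<^sub>R v 1 - ?R $$ (0, i) *\<^sub>R v 0"
    unfolding transpose_Rmat_B_N[OF R] mat_app_def using i
    by (simp add: boundary_sign_def numeral_2_eq_2)
  finally show ?thesis unfolding v_def .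
qed

section \<open>Entropy balance of one element\<close>

text \<open>The factor 2 is what makes this work: \<open>2 * X = (X + Y) + (X - Y)\<close>, with
  \<open>X\<close> and \<open>Y\<close> pairing the flux with \<open>w i\<close> and
  \<open>w k\<close>. The SBP property and symmetry reduce \<open>X + Y\<close> to boundary terms,
  entropy conservation and the SBP property reduce \<open>X - Y\<close>.\<close>

lemma flux_differencing:
  fixes Q :: "nat \<Rightarrow> nat \<Rightarrow> real" and w :: "nat \<Rightarrow> 'a::real_inner"
  assumes sbp: "\<And>i k. i < n \<Longrightarrow> k < n \<Longrightarrow> Q i k + Q k i = (if i = k then e i else 0)"
    and row_sum: "\<And>i. i < n \<Longrightarrow> (\<Sum>k<n. Q i k) = 0"
    and sym: "\<And>i k. i < n \<Longrightarrow> k < n \<Longrightarrow> g i k = g k i"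
    and ec: "\<And>i k. i < n \<Longrightarrow> k < n \<Longrightarrow> (w i - w k) \<bullet> g i k = \<psi> i - \<psi> k"
  shows "(\<Sum>i<n. w i \<bullet> (\<Sum>k<n. (2 * Q i k) *\<^sub>R g i k)) = (\<Sum>i<n. e i * (w i \<bullet> g i i - \<psi> i))"
proof -
  let ?d = "\<lambda>i k. if i = k then e i else 0"
  define X where "X = (\<Sum>i<n. \<Sum>k<n. Q i k * (w i \<bullet> g i k))"
  define Y where "Y = (\<Sum>i<n. \<Sum>k<n. Q i k * (w k \<bullet> g i k))"
  have Q: "Q i k = ?d i k - Q k i" if "i < n" "k < n" for i k using sbp[OF that] by simp
  have diag: "(\<Sum>i<n. \<Sum>k<n. ?d i k * a i k) = (\<Sum>i<n. e i * a i i)" for a :: "nat \<Rightarrow> nat \<Rightarrow> real"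
  proof (rule sum.cong[OF refl])
    fix i assume "i \<in> {..<n}"
    have "(\<Sum>k<n. ?d i k * a i k) = (\<Sum>k<n. if i = k then e i * a i i else 0)"
      by (rule sum.cong) auto
    then show "(\<Sum>k<n. ?d i k * a i k) = e i * a i i" using \<open>i \<in> {..<n}\<close> by simp
  qed
  \<comment> \<open>Only the subtracted part takes the flux as \<open>g k i\<close>, so that
    exchanging the summation indices turns it into \<open>Y\<close>.\<close>
  have "X = (\<Sum>i<n. \<Sum>k<n. ?d i k * (w i \<bullet> g i k) - Q k i * (w i \<bullet> g k i))"
    unfolding X_def
  proof (intro sum.cong refl)
    fix i k assume "i \<in> {..<n}" "k \<in> {..<n}"
    then have "Q i k = ?d i k - Q k i" "g k i = g i k" using Q sym by blast+
    then show "Q i k * (w i \<bullet> g i k) = ?d i k * (w i \<bullet> g i k) - Q k i * (w i \<bullet> g k i)"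
      by (simp only: left_diff_distrib)
  qed
  also have "\<dots> = (\<Sum>i<n. e i * (w i \<bullet> g i i)) - (\<Sum>i<n. \<Sum>k<n. Q k i * (w i \<bullet> g k i))"
    by (simp only: sum_subtractf diag)
  also have "(\<Sum>i<n. \<Sum>k<n. Q k i * (w i \<bullet> g k i)) = Y"
    unfolding Y_def by (rule sum.swap)
  finally have X: "X = (\<Sum>i<n. e i * (w i \<bullet> g i i)) - Y" .
  have "X - Y = (\<Sum>i<n. \<Sum>k<n. Q i k * ((w i - w k) \<bullet> g i k))"
    unfolding X_def Y_def by (simp only: sum_subtractf inner_diff_left right_diff_distrib)
  also have "\<dots> = (\<Sum>i<n. \<Sum>k<n. Q i k * \<psi> i - Q i k * \<psi> k)"
    by (intro sum.cong refl) (simp add: ec right_diff_distrib)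
  also have "\<dots> = (\<Sum>i<n. (\<Sum>k<n. Q i k) * \<psi> i) - (\<Sum>i<n. \<Sum>k<n. Q i k * \<psi> k)"
    by (simp only: sum_subtractf sum_distrib_right)
  also have "(\<Sum>i<n. (\<Sum>k<n. Q i k) * \<psi> i) = 0"
    by (simp add: row_sum)
  also have "(\<Sum>i<n. \<Sum>k<n. Q i k * \<psi> k) = (\<Sum>k<n. \<Sum>i<n. Q i k * \<psi> k)" by (rule sum.swap)
  \<comment> \<open>The \<open>\<psi> k\<close> part involves column sums of \<open>Q\<close>. The
    SBP property, used a second time, trades them for row sums, which vanish, and the diagonal
    \<open>e\<close>.\<close>
  also have "\<dots> = (\<Sum>k<n. \<Sum>i<n. ?d k i * \<psi> k - Q k i * \<psi> k)"
  proof (intro sum.cong refl)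
    fix i k assume "i \<in> {..<n}" "k \<in> {..<n}"
    then have "Q i k = ?d k i - Q k i" using Q[of i k] by auto
    then show "Q i k * \<psi> k = ?d k i * \<psi> k - Q k i * \<psi> k"
      by (simp only: left_diff_distrib)
  qed
  also have "\<dots> = (\<Sum>k<n. e k * \<psi> k) - (\<Sum>k<n. (\<Sum>i<n. Q k i) * \<psi> k)"
    by (simp only: sum_subtractf sum_distrib_right diag)
  also have "(\<Sum>k<n. (\<Sum>i<n. Q k i) * \<psi> k) = 0"
    by (simp add: row_sum)
  finally have XY: "X - Y = - (\<Sum>i<n. e i * \<psi> i)" by simp
  have "(\<Sum>i<n. w i \<bullet> (\<Sum>k<n. (2 * Q i k) *\<^sub>R g i k)) = 2 * X"
    unfolding X_def by (simp add: inner_sum_right sum_distrib_left mult.assoc)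
  also have "\<dots> = (\<Sum>i<n. e i * (w i \<bullet> g i i)) - (\<Sum>i<n. e i * \<psi> i)"
    using X XY by simp
  finally show ?thesis by (simp only: right_diff_distrib sum_subtractf)
qed

text \<open>For \<open>g = flux c u\<close> this is \<open>- entropy_flux c u\<close>, so it is
  minus an entropy flux through the boundary point. It serves as the \<open>h\<close> of
  \<open>boundary_splitting\<close>.\<close>

definition entropy_potential :: "'a::real_inner conservation_law \<Rightarrow> 'a \<Rightarrow> 'a \<Rightarrow> real" where
  "entropy_potential c u g = flux_potential c u - entropy_var c u \<bullet> g"

text \<open>By consistency, the volume term contributes the difference of
  \<open>w \<bullet> f - \<psi>\<close> between the ends; the surface term contributes that of
  \<open>w \<bullet> (g - f)\<close>. Both enter the rate with a minus sign, and the physical flux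
  \<open>f\<close> cancels.\<close>

lemma element_entropy_rate:
  fixes c :: "'a::euclidean_space conservation_law"
  assumes S: "sbp_operator S" and diag: "diagonal_mat (Mmat S)" and nr: "nodal_restriction S"
    and flux: "numerical_flux c fvol" "symmetric_flux c fvol" "entropy_conservative_flux c fvol"
    and v: "\<And>i. i < num_nodes S \<Longrightarrow> v i \<in> states c"
  shows "entropy_rate c S v (element_rhs c fvol S v fb)
    = entropy_potential c (mat_app (Rmat S) v 1) (fb 1) - entropy_potential c (mat_app (Rmat S) v 0) (fb 0)"
proof -
  let ?n = "num_nodes S" and ?M = "Mmat S" and ?R = "Rmat S" and ?D = "Dmat S"
  define w \<psi> f where "w = (\<lambda>i. entropy_var c (v i))" "\<psi> = (\<lambda>i. flux_potential c (v i))" "f = (\<lambda>i. flux c (v i))"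
  define Q where "Q = (\<lambda>i k. ?M $$ (i, i) * ?D $$ (i, k))"
  note D = sbp_carrier(1)[OF S] and M = sbp_carrier(2)[OF S] and R = sbp_carrier(3)[OF S]
  obtain l r where lr: "l < ?n" "r < ?n"
    and R0: "\<And>k. k < ?n \<Longrightarrow> ?R $$ (0, k) = (if k = l then 1 else 0)"
    and R1: "\<And>k. k < ?n \<Longrightarrow> ?R $$ (1, k) = (if k = r then 1 else 0)"
    and app: "\<And>v :: nat \<Rightarrow> 'a. mat_app ?R v 0 = v l" "\<And>v :: nat \<Rightarrow> 'a. mat_app ?R v 1 = v r"
    by (rule nodal_restrictionE[OF nr R, where 'a='a]) (rule that)
  \<comment> \<open>The diagonal of the boundary operator for unit rows. Writing it as a difference
    of indicators also covers \<open>l = r\<close>.\<close>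
  define e where "e = (\<lambda>i. (if i = r then 1 else 0) - (if i = l then 1 else 0 :: real))"
  have MD: "(?M * ?D) $$ (i, k) = Q i k" if "i < ?n" "k < ?n" for i k
    unfolding Q_def by (rule diagonal_mult_entry[OF diag M D that])
  have DM: "(?D\<^sup>T * ?M) $$ (i, k) = Q k i" if "i < ?n" "k < ?n" for i k
    unfolding Q_def using mult_diagonal_entry[OF diag M _ that, of "?D\<^sup>T"] D that by simp
  have vol: "(\<Sum>i<?n. w i \<bullet> (\<Sum>k<?n. (2 * Q i k) *\<^sub>R fvol (v i) (v k))) = (\<Sum>i<?n. e i * (w i \<bullet> fvol (v i) (v i) - \<psi> i))"
  proof (rule flux_differencing)
    fix i k assume ik: "i < ?n" "k < ?n"
    have "Q i k + Q k i = (?M * ?D + ?D\<^sup>T * ?M) $$ (i, k)"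
      using MD DM ik M D by simp
    also have "\<dots> = ?R $$ (1, i) * ?R $$ (1, k) - ?R $$ (0, i) * ?R $$ (0, k)"
      unfolding sbp_carrier(4)[OF S] by (rule boundary_op_entry[OF R ik])
    also have "\<dots> = (if i = k then e i else 0)" unfolding R0[OF ik(1)] R0[OF ik(2)] R1[OF ik(1)] R1[OF ik(2)] e_def by simp
    finally show "Q i k + Q k i = (if i = k then e i else 0)" .
    show "fvol (v i) (v k) = fvol (v k) (v i)"
      using flux(2) v ik unfolding symmetric_flux_def by blast
    \<comment> \<open>In \<open>entropy_conservative_flux\<close> the state with the positive sign
      is the second argument, here it is the first; the symmetry just shown exchanges them.\<close>
    then show "(w i - w k) \<bullet> fvol (v i) (v k) = \<psi> i - \<psi> k"
      using flux(3) v[OF ik(1)] v[OF ik(2)] unfolding entropy_conservative_flux_def w_\<psi>_f_def by fastforce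
  next
    fix i assume "i < ?n"
    then show "(\<Sum>k<?n. Q i k) = 0"
      using derivative_row_sum[OF S] by (simp add: Q_def sum_distrib_left[symmetric])
  qed
  also have "\<dots> = (\<Sum>i<?n. e i * (w i \<bullet> f i - \<psi> i))"
    using flux(1) v unfolding numerical_flux_def w_\<psi>_f_def by (intro sum.cong) auto
  also have "\<dots> = (w r \<bullet> f r - \<psi> r) - (w l \<bullet> f l - \<psi> l)"
    using lr unfolding e_def left_diff_distrib sum_subtractf
    by (simp add: if_distrib if_distribR cong: if_cong)
  finally have vol': "(\<Sum>i<?n. w i \<bullet> (\<Sum>k<?n. (2 * Q i k) *\<^sub>R fvol (v i) (v k)))
      = (w r \<bullet> f r - \<psi> r) - (w l \<bullet> f l - \<psi> l)" .
  have rhs: "mat_app ?M (element_rhs c fvol S v fb) i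
      = - (\<Sum>k<?n. (2 * Q i k) *\<^sub>R fvol (v i) (v k))
        - ((if i = r then fb 1 - f r else 0) - (if i = l then fb 0 - f l else 0))" if i: "i < ?n" for i
  proof -
    have "mat_app ?M (element_rhs c fvol S v fb) i
        = - (?M $$ (i, i) *\<^sub>R vol_term fvol S v i) - mat_app ?M (surf_term c S v fb) i"
      unfolding mat_app_diagonal[OF diag M i] element_rhs_def by (simp add: scaleR_diff_right)
    also have "?M $$ (i, i) *\<^sub>R vol_term fvol S v i = (\<Sum>k<?n. (2 * Q i k) *\<^sub>R fvol (v i) (v k))"
      unfolding vol_term_def Q_def by (simp add: scaleR_sum_right mult_ac)
    also have "mat_app ?M (surf_term c S v fb) i = (if i = r then fb 1 - f r else 0) - (if i = l then fb 0 - f l else 0)"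
      unfolding mass_surf_term[OF S i] app w_\<psi>_f_def using R0[OF i] R1[OF i] by simp
    finally show ?thesis .
  qed
  have "entropy_rate c S v (element_rhs c fvol S v fb)
      = - (\<Sum>i<?n. w i \<bullet> (\<Sum>k<?n. (2 * Q i k) *\<^sub>R fvol (v i) (v k)))
        - ((\<Sum>i<?n. if i = r then w r \<bullet> (fb 1 - f r) else 0) - (\<Sum>i<?n. if i = l then w l \<bullet> (fb 0 - f l) else 0))"
    unfolding entropy_rate_def sum_negf[symmetric] sum_subtractf[symmetric] w_\<psi>_f_def(1)[symmetric]
    by (intro sum.cong refl) (auto simp: rhs w_\<psi>_f_def(1) inner_diff_right)
  also have "\<dots> = (\<psi> r - w r \<bullet> fb 1) - (\<psi> l - w l \<bullet> fb 0)"
    unfolding vol' using lr by (simp add: inner_diff_right)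
  finally show ?thesis unfolding app entropy_potential_def w_\<psi>_f_def .
qed

section \<open>Time derivative of the total entropy and summation over the mesh\<close>

lemma entropy_potential_jump:
  "entropy_potential c um g - entropy_potential c up g
    = (entropy_var c up - entropy_var c um) \<bullet> g - (flux_potential c up - flux_potential c um)"
  by (simp add: entropy_potential_def inner_diff_left)

text \<open>A diagonal mass matrix makes the total entropy a weighted sum of nodal entropies, and
  the chain rule applies node by node because \<open>w\<close> is the gradient of the
  entropy.\<close>

lemma total_entropy_derivative:
  fixes c :: "'a::euclidean_space conservation_law"
  assumes c: "entropy_setting c"
    and els: "\<And>S. S \<in> set els \<Longrightarrow> sbp_operator S" "\<And>S. S \<in> set els \<Longrightarrow> diagonal_mat (Mmat S)"
    and adm: "admissible c els (u t)"
    and der: "\<And>j i. j < length els \<Longrightarrow> i < num_nodes (els ! j) \<Longrightarrow>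
      ((\<lambda>s. u s j i) has_vector_derivative du j i) (at t within T)"
  shows "((\<lambda>s. total_entropy c els (u s)) has_real_derivative
    (\<Sum>j<length els. entropy_rate c (els ! j) (u t j) (du j))) (at t within T)"
proof -
  have node: "((\<lambda>s. mat_app (Mmat (els ! j)) (\<lambda>k. entropy c (u s j k)) i) has_real_derivative
      entropy_var c (u t j i) \<bullet> mat_app (Mmat (els ! j)) (du j) i) (at t within T)"
    if j: "j < length els" and i: "i < num_nodes (els ! j)" for i j
  proof -
    let ?M = "Mmat (els ! j)" and ?w = "entropy_var c (u t j i)"
    have in_set: "els ! j \<in> set els" using j by simp
    note app = mat_app_diagonal[OF els(2)[OF in_set] sbp_carrier(2)[OF els(1)[OF in_set]] i]
    have "u t j i \<in> states c" using adm j i unfolding admissible_def by blast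
    then have "(entropy c has_derivative (\<lambda>h. h \<bullet> ?w)) (at (u t j i))"
      using c unfolding entropy_setting_def gderiv_def by blast
    then have "((\<lambda>s. entropy c (u s j i)) has_derivative (\<lambda>h. (h *\<^sub>R du j i) \<bullet> ?w)) (at t within T)"
      using der[OF j i] unfolding has_vector_derivative_def by (rule has_derivative_compose[rotated])
    then have "((\<lambda>s. entropy c (u s j i)) has_real_derivative ?w \<bullet> du j i) (at t within T)"
      unfolding has_field_derivative_def
      by (rule has_derivative_eq_rhs) (auto simp: inner_commute)
    from DERIV_cmult[OF this, of "?M $$ (i, i)"] show ?thesis unfolding app by simp
  qed
  show ?thesis
    unfolding total_entropy_def entropy_rate_def
    by (intro DERIV_sum node) auto
qed

text \<open>The right end of element \<open>j\<close> and the left end of element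
  \<open>Suc j\<close> share the flux value at point \<open>Suc j\<close>. Shifting the index of the
  left ends pairs them; the first left end and the last right end remain.\<close>

lemma sum_interface_contributions:
  assumes "els \<noteq> []"
  shows "(\<Sum>j<length els. h (right_state els u j) (surface_flux fnum els gl gr u (Suc j))
      - h (left_state els u j) (surface_flux fnum els gl gr u j))
    = domain_boundary_term els h gl gr u + (\<Sum>j<length els - 1. interface_contribution fnum els h u j)"
proof -
  obtain m where m: "length els = Suc m" using assms by (cases els) auto
  let ?F = "surface_flux fnum els gl gr u"
  have "(\<Sum>j<Suc m. h (right_state els u j) (?F (Suc j)) - h (left_state els u j) (?F j))
     = (\<Sum>j<Suc m. h (right_state els u j) (?F (Suc j))) - (\<Sum>j<Suc m. h (left_state els u j) (?F j))"
    by (rule sum_subtractf)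
  also have "(\<Sum>j<Suc m. h (right_state els u j) (?F (Suc j)))
      = (\<Sum>j<m. h (right_state els u j) (?F (Suc j))) + h (right_state els u m) gr"
    by (simp add: surface_flux_def m)
  also have "(\<Sum>j<Suc m. h (left_state els u j) (?F j))
      = h (left_state els u 0) gl + (\<Sum>j<m. h (left_state els u (Suc j)) (?F (Suc j)))"
    by (subst sum.lessThan_Suc_shift) (simp add: surface_flux_def)
  finally have "(\<Sum>j<Suc m. h (right_state els u j) (?F (Suc j)) - h (left_state els u j) (?F j))
    = domain_boundary_term els h gl gr u
      + (\<Sum>j<m. h (right_state els u j) (?F (Suc j)) - h (left_state els u (Suc j)) (?F (Suc j)))"
    by (simp add: domain_boundary_term_def m sum_subtractf)
  also have "(\<Sum>j<m. h (right_state els u j) (?F (Suc j)) - h (left_state els u (Suc j)) (?F (Suc j)))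
    = (\<Sum>j<m. interface_contribution fnum els h u j)"
    \<comment> \<open>For \<open>j < m\<close> the point \<open>Suc j\<close> is neither 0 nor
      \<open>length els\<close>, hence an interior one where \<open>surface_flux\<close> is given by
      \<open>fnum\<close>.\<close>
    by (intro sum.cong refl) (simp add: interface_contribution_def surface_flux_def Let_def m)
  finally show ?thesis by (simp add: m)
qed

section \<open>Conservation and stability across elements\<close>

theorem theorem3p2:
  fixes c :: "'a::euclidean_space conservation_law"
    and fvol fnum :: "'a \<Rightarrow> 'a \<Rightarrow> 'a"
    and els :: "sbp_element list"
  assumes "entropy_setting c"
    and "mesh els"
    and "numerical_flux c fvol"
    and "symmetric_flux c fvol"
    and "entropy_conservative_flux c fvol"
    and "numerical_flux c fnum"
    and "\<And>S. S \<in> set els \<Longrightarrow> diagonal_mat (Mmat S)"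
    and "\<And>S. S \<in> set els \<Longrightarrow> diagonal_mat (boundary_op S)"
    and "\<And>S. S \<in> set els \<Longrightarrow> accuracy S < 2 \<Longrightarrow> nodal_restriction S"
  shows "(entropy_conservative_flux c fnum \<longrightarrow> entropy_conservative_across_elements c fvol fnum els) \<and>
         (entropy_stable_flux c fnum \<longrightarrow> entropy_stable_across_elements c fvol fnum els)"
proof -
  let ?h = "entropy_potential c"
  \<comment> \<open>Accuracy at least 2 yields nodal boundary values from diagonality; for lower
    accuracy they are assumed.\<close>
  have S: "sbp_operator S" and nr: "nodal_restriction S" if "S \<in> set els" for S
  proof -
    show S: "sbp_operator S" using assms(2) that unfolding mesh_def by blast
    show "nodal_restriction S"
      using nodal_restriction_if_diagonal_boundary_op[OF S assms(8)[OF that]] assms(9)[OF that] by linarith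
  qed
  have ne: "els \<noteq> []" using assms(2) unfolding mesh_def by blast
  have rate: "entropy_rate c S v (element_rhs c fvol S v fb)
      = ?h (mat_app (Rmat S) v 1) (fb 1) - ?h (mat_app (Rmat S) v 0) (fb 0)"
    if "S \<in> set els" "\<And>i. i < num_nodes S \<Longrightarrow> v i \<in> states c" for S v fb
    using element_entropy_rate[OF S assms(7) nr assms(3-5)] that by blast
  have split: "boundary_splitting c fvol els ?h"
    unfolding boundary_splitting_def using rate by blast
  \<comment> \<open>The conditions on \<open>fnum\<close> hold for admissible states only. Boundary
    states are admissible because they are nodal values.\<close>
  have states: "left_state els u j \<in> states c" "right_state els u j \<in> states c"
    if adm: "admissible c els u" and j: "j < length els" for u j
  proof -
    have in_set: "els ! j \<in> set els" using j by simp
    obtain l r where "l < num_nodes (els ! j)" "r < num_nodes (els ! j)"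
      "mat_app (Rmat (els ! j)) (u j) 0 = u j l" "mat_app (Rmat (els ! j)) (u j) 1 = u j r"
      by (rule nodal_restrictionE[OF nr[OF in_set] sbp_carrier(3)[OF S[OF in_set]], where 'a='a]) (rule that)
    then show "left_state els u j \<in> states c" "right_state els u j \<in> states c"
      using adm j unfolding admissible_def left_state_def right_state_def by auto
  qed
  have deriv: "((\<lambda>s. total_entropy c els (u s)) has_real_derivative
      domain_boundary_term els ?h (gl t) (gr t) (u t)
        + (\<Sum>j<length els - 1. interface_contribution fnum els ?h (u t) j)) (at t within T)"
    if sol: "scheme_solution c fvol fnum els T gl gr u" and t: "t \<in> T" for T gl gr u t
  proof -
    let ?F = "surface_flux fnum els (gl t) (gr t) (u t)"
    \<comment> \<open>\<open>b = 0\<close> gives point \<open>j\<close>, the left end, and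
      \<open>b = 1\<close> gives point \<open>Suc j\<close>, the right end.\<close>
    let ?du = "\<lambda>j. element_rhs c fvol (els ! j) (u t j) (\<lambda>b. ?F (j + b))"
    have adm: "admissible c els (u t)"
      and der: "\<And>j i. j < length els \<Longrightarrow> i < num_nodes (els ! j) \<Longrightarrow>
        ((\<lambda>s. u s j i) has_vector_derivative ?du j i) (at t within T)"
      using sol t unfolding scheme_solution_def by blast+
    have "entropy_rate c (els ! j) (u t j) (?du j)
        = ?h (right_state els (u t) j) (?F (Suc j)) - ?h (left_state els (u t) j) (?F j)"
      if "j < length els" for j
      using rate[of "els ! j" "u t j"] adm that unfolding admissible_def left_state_def right_state_def by simp
    then have "(\<Sum>j<length els. entropy_rate c (els ! j) (u t j) (?du j))
        = domain_boundary_term els ?h (gl t) (gr t) (u t)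
          + (\<Sum>j<length els - 1. interface_contribution fnum els ?h (u t) j)"
      unfolding sum_interface_contributions[OF ne, symmetric] by (intro sum.cong refl) simp
    then show ?thesis
      using total_entropy_derivative[where u = u and t = t and T = T and du = ?du, OF assms(1) S assms(7) adm der]
      by simp
  qed
  have adm: "admissible c els (u t)" if "scheme_solution c fvol fnum els T gl gr u" "t \<in> T" for T gl gr u t
    using that unfolding scheme_solution_def by blast
  show ?thesis
  proof (intro conjI impI)
    assume ec: "entropy_conservative_flux c fnum"
    have zero: "interface_contribution fnum els ?h u j = 0" if "admissible c els u" "Suc j < length els" for u j
      using ec states(2)[of u j] states(1)[of u "Suc j"] that
      unfolding interface_contribution_def Let_def entropy_potential_jump entropy_conservative_flux_def by simp
    have "((\<lambda>s. total_entropy c els (u s)) has_real_derivative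
        domain_boundary_term els ?h (gl t) (gr t) (u t)) (at t within T)"
      if "scheme_solution c fvol fnum els T gl gr u" "t \<in> T" for T gl gr u t
      using deriv[OF that] zero[OF adm[OF that]] by simp
    with split zero show "entropy_conservative_across_elements c fvol fnum els"
      unfolding entropy_conservative_across_elements_def by blast
  next
    assume es: "entropy_stable_flux c fnum"
    have nonpos: "interface_contribution fnum els ?h u j \<le> 0" if "admissible c els u" "Suc j < length els" for u j
      using es states(2)[of u j] states(1)[of u "Suc j"] that
      unfolding interface_contribution_def Let_def entropy_potential_jump entropy_stable_flux_def by simp
    have "\<exists>d. ((\<lambda>s. total_entropy c els (u s)) has_real_derivative d) (at t within T) \<and>
        d \<le> domain_boundary_term els ?h (gl t) (gr t) (u t)"
      if "scheme_solution c fvol fnum els T gl gr u" "t \<in> T" for T gl gr u t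
    proof -
      \<comment> \<open>The witness for \<open>d\<close> is the exact derivative from
        \<open>deriv\<close>, which exceeds the domain boundary term by this sum.\<close>
      have "(\<Sum>j<length els - 1. interface_contribution fnum els ?h (u t) j) \<le> 0"
        using nonpos[OF adm[OF that]] by (intro sum_nonpos) simp
      with deriv[OF that] show ?thesis by (intro exI conjI) (assumption, simp)
    qed
    with split nonpos show "entropy_stable_across_elements c fvol fnum els"
      unfolding entropy_stable_across_elements_def by blast
  qed
qed

end
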